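(* Let $\mathfrak{X}$ be a complex linear space and let $\mathfrak{t},\mathfrak{w}\in\mathcal{F}_+(\mathfrak{X})$ be forms. Then there exists a $(\ll,\perp)$-type decomposition of $\mathfrak{t}$ with respect to $\mathfrak{w}$, namely $$\mathfrak{t}=\mathfrak{t}_{\ker\mathfrak{w}}+(\mathfrak{t}-\mathfrak{t}_{\ker\mathfrak{w}}),$$ where the first summand is $\mathfrak{w}$-absolutely continuous and the second one is a form which is $\mathfrak{w}$-singular. Furthermore, $\mathfrak{t}_{\ker\mathfrak{w}}$ is the maximum of the set $$\{\mathfrak{s}\in\mathcal{F}_+(\mathfrak{X}) : \mathfrak{s}\leq\mathfrak{t}\ \text{and}\ \mathfrak{s}\ll\mathfrak{w}\}.$$ The $(\ll,\perp)$-type decomposition of $\mathfrak{t}$ with respect to $\mathfrak{w}$ is unique if and only if $\mathfrak{t}_{\ker\mathfrak{w}}$ is dominated by $\mathfrak{w}$.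
   Context: A form on a complex linear space $\mathfrak{X}$ is a nonnegative sesquilinear form $\mathfrak{t}:\mathfrak{X}\times\mathfrak{X}\to\mathbb{C}$ (linear in the first, antilinear in the second argument, with $\mathfrak{t}[x]:=\mathfrak{t}(x,x)\geq 0$ for all $x$). $\mathcal{F}_+(\mathfrak{X})$ is the set of forms on $\mathfrak{X}$, ordered by $\mathfrak{t}\leq\mathfrak{w}$ iff $\mathfrak{t}[x]\leq\mathfrak{w}[x]$ for all $x\in\mathfrak{X}$. The kernel is the linear subspace $\ker\mathfrak{t}=\{x\in\mathfrak{X}:\mathfrak{t}[x]=0\}$. A form is uniquely determined by its quadratic form $x\mapsto\mathfrak{t}[x]$. For a linear subspace $\mathfrak{Y}\subseteq\mathfrak{X}$, the short of $\mathfrak{t}$ to $\mathfrak{Y}$ is the form $\mathfrak{t}_{\mathfrak{Y}}$ with quadratic form $\mathfrak{t}_{\mathfrak{Y}}[x]=\inf_{y\in\mathfrak{Y}}\mathfrak{t}[x-y]$, $x\in\mathfrak{X}$; $\mathfrak{t}_{\ker\mathfrak{w}}$ is the case $\mathfrak{Y}=\ker\mathfrak{w}$. $\mathfrak{t}$ is dominated by $\mathfrak{w}$ if there is a constant $c$ with $\mathfrak{t}\leq c\,\mathfrak{w}$. $\mathfrak{t}$ is $\mathfrak{w}$-absolutely continuous ($\mathfrak{t}\ll\mathfrak{w}$) if $\ker\mathfrak{w}\subseteq\ker\mathfrak{t}$. $\mathfrak{t}$ and $\mathfrak{w}$ are singular ($\mathfrak{t}\perp\mathfrak{w}$; $\mathfrak{t}$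 is $\mathfrak{w}$-singular) if every $\mathfrak{s}\in\mathcal{F}_+(\mathfrak{X})$ with $\mathfrak{s}\leq\mathfrak{t}$ and $\mathfrak{s}\leq\mathfrak{w}$ is $0$. A $(\ll,\perp)$-type (short-type) decomposition of $\mathfrak{t}$ with respect to $\mathfrak{w}$ is a representation $\mathfrak{t}=\mathfrak{t}_1+\mathfrak{t}_2$ with $\mathfrak{t}_1,\mathfrak{t}_2\in\mathcal{F}_+(\mathfrak{X})$, $\mathfrak{t}_1\ll\mathfrak{w}$ and $\mathfrak{t}_2\perp\mathfrak{w}$. *)

theory Defs
  imports Complex_Main "HOL-Library.Function_Algebras"
begin

text \<open>
  The complex linear space is a type \<open>'a::ab_group_add\<close> with a scalar multiplication
  \<open>scale\<close> satisfying the library locale \<open>vector_space\<close>. Sums, differences and the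
  zero of forms are the pointwise ones of \<open>HOL-Library.Function_Algebras\<close>.
\<close>

definition forms ::
    "(complex \<Rightarrow> 'a \<Rightarrow> 'a) \<Rightarrow> ('a::ab_group_add \<Rightarrow> 'a \<Rightarrow> complex) set" where
  "forms scale = {t.
     (\<forall>x x' y. t (x + x') y = t x y + t x' y) \<and>
     (\<forall>c x y. t (scale c x) y = c * t x y) \<and>
     (\<forall>x y y'. t x (y + y') = t x y + t x y') \<and>
     (\<forall>c x y. t x (scale c y) = cnj c * t x y) \<and>
     (\<forall>x. t x x \<in> \<real> \<and> 0 \<le> Re (t x x))}"

text \<open>The real part loses nothing, since \<open>t x x\<close> is real for every form.\<close>

definition qform :: "('a \<Rightarrow> 'a \<Rightarrow> complex) \<Rightarrow> 'a \<Rightarrow> real" where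
  "qform t x = Re (t x x)"

definition form_le :: "('a \<Rightarrow> 'a \<Rightarrow> complex) \<Rightarrow> ('a \<Rightarrow> 'a \<Rightarrow> complex) \<Rightarrow> bool" where
  "form_le t w \<longleftrightarrow> (\<forall>x. qform t x \<le> qform w x)"

definition ker_form :: "('a \<Rightarrow> 'a \<Rightarrow> complex) \<Rightarrow> 'a set" where
  "ker_form t = {x. qform t x = 0}"

text \<open>
  Exactly one form has this quadratic form whenever \<open>Y\<close> is a linear subspace: see \<open>ex1_short\<close> below.
\<close>

definition short ::
    "(complex \<Rightarrow> 'a \<Rightarrow> 'a) \<Rightarrow> ('a::ab_group_add \<Rightarrow> 'a \<Rightarrow> complex) \<Rightarrow> 'a set
      \<Rightarrow> ('a \<Rightarrow> 'a \<Rightarrow> complex)" where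
  "short scale t Y =
     (THE s. s \<in> forms scale \<and> (\<forall>x. qform s x = (INF y\<in>Y. qform t (x - y))))"

definition dominated :: "('a \<Rightarrow> 'a \<Rightarrow> complex) \<Rightarrow> ('a \<Rightarrow> 'a \<Rightarrow> complex) \<Rightarrow> bool" where
  "dominated t w \<longleftrightarrow> (\<exists>c::real. 0 \<le> c \<and> form_le t (\<lambda>x y. of_real c * w x y))"

definition abs_cont :: "('a \<Rightarrow> 'a \<Rightarrow> complex) \<Rightarrow> ('a \<Rightarrow> 'a \<Rightarrow> complex) \<Rightarrow> bool" where
  "abs_cont t w \<longleftrightarrow> ker_form w \<subseteq> ker_form t"

definition singular ::
    "(complex \<Rightarrow> 'a \<Rightarrow> 'a) \<Rightarrow> ('a::ab_group_add \<Rightarrow> 'a \<Rightarrow> complex)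
      \<Rightarrow> ('a \<Rightarrow> 'a \<Rightarrow> complex) \<Rightarrow> bool" where
  "singular scale t w \<longleftrightarrow>
     (\<forall>s \<in> forms scale. form_le s t \<and> form_le s w \<longrightarrow> s = 0)"

definition short_type_decomp ::
    "(complex \<Rightarrow> 'a \<Rightarrow> 'a) \<Rightarrow> ('a::ab_group_add \<Rightarrow> 'a \<Rightarrow> complex)
      \<Rightarrow> ('a \<Rightarrow> 'a \<Rightarrow> complex) \<Rightarrow> ('a \<Rightarrow> 'a \<Rightarrow> complex) \<times> ('a \<Rightarrow> 'a \<Rightarrow> complex) \<Rightarrow> bool" where
  "short_type_decomp scale t w = (\<lambda>(t1, t2).
     t1 \<in> forms scale \<and> t2 \<in> forms scale \<and> t = t1 + t2 \<and>
     abs_cont t1 w \<and> singular scale t2 w)"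

lemma form_diff:
  assumes "vector_space scale" "t \<in> forms scale"
  shows "t (x - x') y = t x y - t x' y" "t x (y - y') = t x y - t x y'"
proof -
  have 1: "t ((x - x') + x') y = t (x - x') y + t x' y"
    and 2: "t x ((y - y') + y') = t x (y - y') + t x y'"
    using assms(2) unfolding forms_def by blast+
  show "t (x - x') y = t x y - t x' y" using 1 by simp
  show "t x (y - y') = t x y - t x y'" using 2 by simp
qed

lemma form_cnj:
  assumes v: "vector_space scale" and t: "t \<in> forms scale"
  shows "t y x = cnj (t x y)"
proof -
  interpret vector_space scale by fact
  have a: "\<And>x x' y. t (x + x') y = t x y + t x' y" "\<And>x y y'. t x (y + y') = t x y + t x y'"
    "\<And>c x y. t (scale c x) y = c * t x y" "\<And>c x y. t x (scale c y) = cnj c * t x y"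
    "\<And>x. Im (t x x) = 0"
    using t unfolding forms_def by (auto simp: complex_is_Real_iff)
  have "Im (t (x + y) (x + y)) = 0" "Im (t (x + scale \<i> y) (x + scale \<i> y)) = 0"
    using a(5) by blast+
  then show ?thesis unfolding a(1-4) by (simp add: a(5) complex_eq_iff)
qed

lemma qform_nonneg: "t \<in> forms scale \<Longrightarrow> 0 \<le> qform t x"
  unfolding forms_def qform_def by auto

lemma qform_diff:
  assumes "vector_space scale" "t \<in> forms scale"
  shows "qform t (x - y) = qform t x + qform t y - 2 * Re (t x y)"
  using form_cnj[OF assms, of y x] by (simp add: qform_def form_diff[OF assms])

lemma form_eqI:
  assumes v: "vector_space scale" and s: "s \<in> forms scale" and t: "t \<in> forms scale"
    and q: "\<And>x. qform s x = qform t x"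
  shows "s = t"
proof (intro ext)
  fix x y
  have R: "Re (s u v) = Re (t u v)" for u v
    using qform_diff[OF v s, of u v] qform_diff[OF v t, of u v] q by simp
  have "s x (scale \<i> y) = cnj \<i> * s x y" "t x (scale \<i> y) = cnj \<i> * t x y"
    using s t unfolding forms_def by blast+
  then have "Im (s x y) = Im (t x y)" using R[of x "scale \<i> y"] by simp
  then show "s x y = t x y" using R by (simp add: complex_eq_iff)
qed

lemma near_min_orthogonal:
  assumes v: "vector_space scale" and t: "t \<in> forms scale"
    and m: "\<And>c. qform t a \<le> qform t (a - scale c z) + e"
    and K: "qform t z \<le> K" "0 < K"
  shows "(cmod (t a z))\<^sup>2 \<le> e * K"
proof -
  define T where "T = t a z"
  define c where "c = T / of_real K"
  have 1: "t a (scale c z) = cnj c * T" "t (scale c z) (scale c z) = c * cnj c * t z z"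
    using t unfolding forms_def T_def by (auto simp: mult.assoc)
  have n: "c * cnj c = of_real ((cmod c)\<^sup>2)" by (rule complex_norm_square[symmetric])
  have cn: "cmod c = cmod T / K" using K by (simp add: c_def norm_divide)
  have "qform t (scale c z) = (cmod c)\<^sup>2 * qform t z"
    unfolding qform_def 1(2) n by simp
  also have "\<dots> \<le> (cmod c)\<^sup>2 * K" using K by (intro mult_left_mono) auto
  also have "\<dots> = (cmod T)\<^sup>2 / K" using K by (simp add: cn power2_eq_square)
  finally have A: "qform t (scale c z) \<le> (cmod T)\<^sup>2 / K" .
  have "cnj c * T = of_real ((cmod T)\<^sup>2 / K)"
    using complex_norm_square[of T] by (simp add: c_def mult.commute)
  then have "Re (t a (scale c z)) = (cmod T)\<^sup>2 / K" using 1(1) by (metis Re_complex_of_real)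
  then have "(cmod T)\<^sup>2 / K \<le> e"
    using m[of c] A qform_diff[OF v t, of a "scale c z"] by linarith
  then show ?thesis using K by (simp add: T_def field_simps)
qed

lemma ex1_short:
  assumes v: "vector_space scale" and t: "t \<in> forms scale" and Y: "module.subspace scale Y"
  shows "\<exists>!s. s \<in> forms scale \<and> (\<forall>x. qform s x = (INF y\<in>Y. qform t (x - y)))"
proof -
  interpret vector_space scale by fact
  define q where "q x = (INF y\<in>Y. qform t (x - y))" for x
  have Y0: "0 \<in> Y" using Y by (rule subspace_0)
  have bdd: "bdd_below ((\<lambda>y. qform t (x - y)) ` Y)" for x
    by (rule bdd_belowI[where m=0]) (auto intro: qform_nonneg[OF t])
  have q_le: "q x \<le> qform t (x - y)" if "y \<in> Y" for x y
    unfolding q_def by (rule cINF_lower[OF bdd that])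
  have "\<exists>y\<in>Y. qform t (x - y) < q x + 1 / real (Suc n)" for x n
    using cINF_less_iff[OF _ bdd, of x "q x + 1 / real (Suc n)"] Y0 by (fastforce simp: q_def)
  then obtain u where u: "\<And>x n. u x n \<in> Y"
    "\<And>x n. qform t (x - u x n) < q x + 1 / real (Suc n)" by metis
  define a where "a x n = x - u x n" for x n
  have aq: "q x \<le> qform t (a x n)" "qform t (a x n) < q x + 1 / real (Suc n)" for x n
    using q_le u by (auto simp: a_def)
  define B where "B x = q x + 1" for x
  have aB: "qform t (a x n) \<le> B x" for x n
  proof -
    have "1 / real (Suc n) \<le> 1" by simp
    then show ?thesis using aq(2)[of x n] unfolding B_def by linarith
  qed
  have q_add: "qform t (x + y) \<le> 2 * qform t x + 2 * qform t y" for x y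
  proof -
    have p: "t (x + y) (x + y) + t (x - y) (x - y) = 2 * t x x + 2 * t y y"
      using t by (simp add: form_diff[OF v t] forms_def)
    have "qform t (x + y) + qform t (x - y) = 2 * qform t x + 2 * qform t y"
      using arg_cong[OF p, of Re] by (simp add: qform_def)
    then show ?thesis using qform_nonneg[OF t, of "x - y"] by linarith
  qed
  have q_sc: "qform t (scale c x) = (cmod c)\<^sup>2 * qform t x" for c x
  proof -
    have "t (scale c x) (scale c x) = (c * cnj c) * t x x"
      using t unfolding forms_def by (auto simp: mult.assoc)
    also have "c * cnj c = of_real ((cmod c)\<^sup>2)" by (rule complex_norm_square[symmetric])
    finally show ?thesis unfolding qform_def by simp
  qed
  have q_sub: "qform t (x - y) \<le> 2 * qform t x + 2 * qform t y" for x y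
    using q_add[of x "scale (-1) y"] q_sc[of "-1" y] by (simp add: scale_minus_left)
  have orth: "(cmod (t (a x n) z))\<^sup>2 \<le> 1 / real (Suc n) * K"
    if "z \<in> Y" "qform t z \<le> K" "0 < K" for x n z K
  proof (rule near_min_orthogonal[OF v t])
    fix c
    have "q x \<le> qform t (x - (u x n + scale c z))"
      by (intro q_le subspace_add[OF Y] subspace_scale[OF Y] u that)
    also have "x - (u x n + scale c z) = a x n - scale c z" by (simp add: a_def)
    finally show "qform t (a x n) \<le> qform t (a x n - scale c z) + 1 / real (Suc n)"
      using aq(2)[of x n] by linarith
  qed (use that in auto)
  have orth0: "(\<lambda>n. t (a x n) (z n)) \<longlonglongrightarrow> 0"
    if "\<And>n. z n \<in> Y" "\<And>n. qform t (z n) \<le> K" "0 < K" for x z K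
  proof -
    have l: "(\<lambda>n. K * (1 / real (Suc n))) \<longlonglongrightarrow> 0"
      using tendsto_mult_right_zero[OF lim_1_over_n[THEN LIMSEQ_Suc]] by simp
    have b: "\<forall>n. (cmod (t (a x n) (z n)))\<^sup>2 \<le> K * (1 / real (Suc n))"
      using orth[OF that] by (simp add: mult.commute)
    have "(\<lambda>n. (cmod (t (a x n) (z n)))\<^sup>2) \<longlonglongrightarrow> 0"
      by (rule tendsto_sandwich[OF _ _ tendsto_const l]) (use b in auto)
    from tendsto_real_sqrt[OF this] have "(\<lambda>n. cmod (t (a x n) (z n))) \<longlonglongrightarrow> 0" by simp
    then show ?thesis by (rule tendsto_norm_zero_cancel)
  qed
  have B1: "B x \<ge> 1" for x
    unfolding B_def q_def using Y0 by (auto intro!: cINF_greatest qform_nonneg[OF t])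
  have aa: "a x n - a x m \<in> Y" for x n m
  proof -
    have "a x n - a x m = u x m - u x n" by (simp add: a_def)
    then show ?thesis using subspace_diff[OF Y u(1) u(1)] by simp
  qed
  have aaB: "qform t (a x n - a x m) \<le> 4 * B x" for x n m
    using q_sub[of "a x n" "a x m"] aB[of x n] aB[of x m] by linarith
  have conv: "convergent (\<lambda>n. t (a x n) (a y n))" for x y
  proof (rule Cauchy_convergent, rule metric_CauchyI)
    fix e :: real assume e: "e > 0"
    define K where "K = 4 * B x + 4 * B y"
    have K: "0 < K" "4 * B x \<le> K" "4 * B y \<le> K" using B1[of x] B1[of y] by (auto simp: K_def)
    obtain M where M: "1 / real (Suc M) < (e / 2)\<^sup>2 / K"
      using nat_approx_posE[of "(e / 2)\<^sup>2 / K"] e K by auto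
    have small: "cmod (t (a x' n) z) < e / 2" if "n \<ge> M" "z \<in> Y" "qform t z \<le> K" for x' n z
    proof -
      have "1 / real (Suc n) \<le> 1 / real (Suc M)" using that(1) by (simp add: frac_le)
      with M have "1 / real (Suc n) < (e / 2)\<^sup>2 / K" by linarith
      then have "1 / real (Suc n) * K < (e / 2)\<^sup>2" using K by (simp add: pos_less_divide_eq)
      with orth[OF that(2,3) K(1), of x' n] have "(cmod (t (a x' n) z))\<^sup>2 < (e / 2)\<^sup>2" by linarith
      then show ?thesis by (rule power2_less_imp_less) (use e in simp)
    qed
    show "\<exists>M. \<forall>m\<ge>M. \<forall>n\<ge>M. dist (t (a x m) (a y m)) (t (a x n) (a y n)) < e"
    proof (intro exI allI impI)
      fix m n assume mn: "M \<le> m" "M \<le> n"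
      have eq: "t (a x m) (a y m) - t (a x n) (a y n)
          = cnj (t (a y m) (a x m - a x n)) + t (a x n) (a y m - a y n)"
        unfolding form_cnj[OF v t, of "a x m - a x n" "a y m", symmetric]
        by (simp add: form_diff[OF v t])
      have "cmod (t (a y m) (a x m - a x n)) < e / 2"
        by (rule small[OF mn(1) aa order_trans[OF aaB K(2)]])
      moreover have "cmod (t (a x n) (a y m - a y n)) < e / 2"
        by (rule small[OF mn(2) aa order_trans[OF aaB K(3)]])
      ultimately show "dist (t (a x m) (a y m)) (t (a x n) (a y n)) < e"
        using norm_triangle_ineq[of "cnj (t (a y m) (a x m - a x n))" "t (a x n) (a y m - a y n)"]
        unfolding dist_norm eq complex_mod_cnj by linarith
    qed
  qed
  define s where "s x y = lim (\<lambda>n. t (a x n) (a y n))" for x y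
  have s: "(\<lambda>n. t (a x n) (a y n)) \<longlonglongrightarrow> s x y" for x y
    using conv unfolding s_def by (rule convergent_LIMSEQ_iff[THEN iffD1])
  have sL: "s x y = L" if "(\<lambda>n. t (a x n) (a y n)) \<longlonglongrightarrow> L" for x y L
    using LIMSEQ_unique[OF s that] .
  have sc: "s y x = cnj (s x y)" for x y
  proof (rule sL)
    have "t (a y n) (a x n) = cnj (t (a x n) (a y n))" for n by (rule form_cnj[OF v t])
    then show "(\<lambda>n. t (a y n) (a x n)) \<longlonglongrightarrow> cnj (s x y)"
      using tendsto_cnj[OF s[of x y]] by simp
  qed
  have sadd: "s x (y + y') = s x y + s x y'" for x y y'
  proof (rule sL)
    let ?z = "\<lambda>n. a (y + y') n - (a y n + a y' n)"
    have "?z n = u y n + u y' n - u (y + y') n" for n by (simp add: a_def)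
    then have z: "?z n \<in> Y" for n using subspace_diff[OF Y subspace_add[OF Y u(1) u(1)] u(1)] by simp
    have zb: "qform t (?z n) \<le> 2 * B (y + y') + 2 * (2 * B y + 2 * B y')" for n
    proof (rule order_trans[OF q_sub add_mono])
      show "2 * qform t (a (y + y') n) \<le> 2 * B (y + y')" using aB by simp
      show "2 * qform t (a y n + a y' n) \<le> 2 * (2 * B y + 2 * B y')"
        using q_add[of "a y n" "a y' n"] aB[of y n] aB[of y' n] by simp
    qed
    have "(\<lambda>n. t (a x n) (?z n)) \<longlonglongrightarrow> 0"
      by (rule orth0[OF z zb]) (use B1[THEN order.strict_trans2[OF zero_less_one]] in \<open>simp add: add_pos_pos\<close>)
    from tendsto_add[OF this tendsto_add[OF s s]]
    have "(\<lambda>n. t (a x n) (?z n) + (t (a x n) (a y n) + t (a x n) (a y' n))) \<longlonglongrightarrow> s x y + s x y'"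
      by simp
    moreover have "t (a x n) (?z n) + (t (a x n) (a y n) + t (a x n) (a y' n))
        = t (a x n) (a (y + y') n)" for n
      using t by (simp add: form_diff[OF v t] forms_def)
    ultimately show "(\<lambda>n. t (a x n) (a (y + y') n)) \<longlonglongrightarrow> s x y + s x y'" by simp
  qed
  have sscale: "s x (scale c y) = cnj c * s x y" for x y c
  proof (rule sL)
    let ?z = "\<lambda>n. a (scale c y) n - scale c (a y n)"
    have "?z n = scale c (u y n) - u (scale c y) n" for n
      by (simp add: a_def scale_right_diff_distrib)
    then have z: "?z n \<in> Y" for n
      using subspace_diff[OF Y subspace_scale[OF Y u(1)] u(1)] by simp
    have zb: "qform t (?z n) \<le> 2 * B (scale c y) + 2 * ((cmod c)\<^sup>2 * B y)" for n
      using q_sub[of "a (scale c y) n" "scale c (a y n)"] q_sc[of c "a y n"]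
        aB[of "scale c y" n] mult_left_mono[OF aB[of y n], of "(cmod c)\<^sup>2"] by simp
    have "0 < 2 * B (scale c y) + 2 * ((cmod c)\<^sup>2 * B y)"
      using B1[of "scale c y"] B1[of y] by (intro add_pos_nonneg) auto
    from orth0[OF z zb this]
    have "(\<lambda>n. t (a x n) (?z n)) \<longlonglongrightarrow> 0" .
    from tendsto_add[OF this tendsto_mult_left[OF s, of "cnj c"]]
    have "(\<lambda>n. t (a x n) (?z n) + cnj c * t (a x n) (a y n)) \<longlonglongrightarrow> cnj c * s x y"
      by simp
    moreover have "t (a x n) (?z n) + cnj c * t (a x n) (a y n) = t (a x n) (a (scale c y) n)" for n
      using t by (simp add: form_diff[OF v t] forms_def)
    ultimately show "(\<lambda>n. t (a x n) (a (scale c y) n)) \<longlonglongrightarrow> cnj c * s x y" by simp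
  qed
  have sq: "qform s x = q x" for x
  proof -
    have l: "(\<lambda>n. q x + 1 / real (Suc n)) \<longlonglongrightarrow> q x"
      using tendsto_add[OF tendsto_const[of "q x"] lim_1_over_n[THEN LIMSEQ_Suc]] by simp
    have "(\<lambda>n. qform t (a x n)) \<longlonglongrightarrow> q x"
      by (rule tendsto_sandwich[OF _ _ tendsto_const l]) (use aq in \<open>auto intro!: always_eventually less_imp_le\<close>)
    moreover have "(\<lambda>n. qform t (a x n)) \<longlonglongrightarrow> qform s x"
      unfolding qform_def by (rule tendsto_Re[OF s])
    ultimately show ?thesis by (rule LIMSEQ_unique[rotated])
  qed
  have "s \<in> forms scale"
    unfolding forms_def
  proof (intro CollectI conjI allI)
    show "s x (y + y') = s x y + s x y'" for x y y' by (rule sadd)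
    show "s x (scale c y) = cnj c * s x y" for x y c by (rule sscale)
    show "s (x + x') y = s x y + s x' y" for x x' y
      using sadd[of y x x'] sc[of "x + x'" y] sc[of x y] sc[of x' y]
        by (metis complex_cnj_add complex_cnj_cnj)
    show "s (scale c x) y = c * s x y" for x y c
      using sscale[of y c x] sc[of "scale c x" y] sc[of x y]
        by (metis complex_cnj_mult complex_cnj_cnj)
    show "s x x \<in> \<real>" for x using sc[of x x] by (simp add: complex_is_Real_iff complex_eq_iff)
    show "0 \<le> Re (s x x)" for x using sq[of x] B1[of x] q_def Y0
      by (auto simp: qform_def[symmetric] intro!: cINF_greatest qform_nonneg[OF t])
  qed
  then show ?thesis using sq form_eqI[OF v] by (intro ex1I[of _ s]) (auto simp: q_def)
qed

end

theory Submission
  imports Defs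
begin

text \<open>
  A form \<open>s \<le> t\<close> vanishing on \<open>ker w\<close> satisfies \<open>s[x] = s[x - y] \<le> t[x - y]\<close> for \<open>y \<in> ker w\<close>; taking
  the infimum gives maximality of \<open>t\<^sub>K\<close>, \<open>K = ker w\<close>, and maximality gives singularity of \<open>t - t\<^sub>K\<close>. If
  \<open>t\<^sub>K \<le> c w\<close> and \<open>t = t1 + t2\<close> is another decomposition, then \<open>t\<^sub>K - t1\<close> lies below both \<open>t2\<close> and
  \<open>c w\<close>, hence vanishes. If \<open>t\<^sub>K\<close> is not dominated by \<open>w\<close>, a gliding hump argument produces a
  linear functional \<open>f\<close> with \<open>\<bar>f\<bar>\<^sup>2 \<le> t\<^sub>K\<close> that is not \<open>w\<close>-bounded. The rank one form \<open>r = f \<otimes> f\<close> is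
  then \<open>w\<close>-singular, and so is \<open>(t - t\<^sub>K) + r\<close>, so \<open>t = (t\<^sub>K - r) + ((t - t\<^sub>K) + r)\<close> is a second
  decomposition.
\<close>

section \<open>Algebra of forms and rank one forms\<close>

lemma qform_simps [simp]:
  "qform 0 x = 0"
  "qform (s + t) x = qform s x + qform t x"
  "qform (s - t) x = qform s x - qform t x"
  "qform (\<lambda>x y. of_real c * t x y) x = c * qform t x"
  by (simp_all add: qform_def)

lemma zero_form: "0 \<in> forms scale"
  by (simp add: forms_def)

lemma add_form: "s \<in> forms scale \<Longrightarrow> t \<in> forms scale \<Longrightarrow> s + t \<in> forms scale"
  by (simp add: forms_def algebra_simps)

lemma diff_form:
  assumes "s \<in> forms scale" "t \<in> forms scale" "form_le s t"
  shows "t - s \<in> forms scale"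
  using assms by (simp add: forms_def form_le_def qform_def algebra_simps)

lemma scaled_form:
  assumes "t \<in> forms scale" "0 \<le> c"
  shows "(\<lambda>x y. of_real c * t x y) \<in> forms scale"
  using assms by (auto simp: forms_def algebra_simps complex_is_Real_iff)

lemma rank_one_form:
  assumes "\<And>x y. f (x + y) = f x + f y" "\<And>c x. f (scale c x) = c * f x"
  shows "(\<lambda>x y. f x * cnj (f y)) \<in> forms scale"
  using assms by (simp add: forms_def algebra_simps complex_is_Real_iff)

lemma qform_rank_one: "qform (\<lambda>x y. f x * cnj (f y)) x = (cmod (f x))\<^sup>2"
  unfolding qform_def complex_norm_square[symmetric] by simp

lemma qform_scale: "t \<in> forms scale \<Longrightarrow> qform t (scale c x) = (cmod c)\<^sup>2 * qform t x"
proof -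
  assume "t \<in> forms scale"
  then have "t (scale c x) (scale c x) = (c * cnj c) * t x x"
    unfolding forms_def by (auto simp: mult.assoc)
  also have "c * cnj c = of_real ((cmod c)\<^sup>2)" by (rule complex_norm_square[symmetric])
  finally show ?thesis unfolding qform_def by simp
qed

section \<open>Cauchy-Schwarz and kernels\<close>

context
  fixes scale :: "complex \<Rightarrow> 'a::ab_group_add \<Rightarrow> 'a"
  assumes v: "vector_space scale"
begin

interpretation vector_space scale by (rule v)

lemma form_le_antisym:
  assumes "s \<in> forms scale" "t \<in> forms scale" "form_le s t" "form_le t s"
  shows "s = t"
  using assms by (intro form_eqI[OF v]) (auto simp: form_le_def intro: antisym)

text \<open>As \<open>qform t (x - scale c y)\<close> is nonnegative, \<open>x\<close> minimises
  along the direction \<open>y\<close> up to the error \<open>qform t x\<close>, so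
  \<open>near_min_orthogonal\<close> applies. It needs a positive bound on \<open>qform t y\<close>,
  hence the slack \<open>d\<close>.\<close>

lemma cauchy_schwarz:
  assumes t: "t \<in> forms scale"
  shows "(cmod (t x y))\<^sup>2 \<le> qform t x * qform t y"
proof (rule field_le_epsilon)
  fix e :: real assume e: "e > 0"
  define d where "d = e / (qform t x + 1)"
  have p: "0 \<le> qform t x" "0 \<le> qform t y" by (rule qform_nonneg[OF t])+
  then have d: "d > 0" using e by (simp add: d_def)
  have "(cmod (t x y))\<^sup>2 \<le> qform t x * (qform t y + d)"
    using p d qform_nonneg[OF t]
    by (intro near_min_orthogonal[OF v t]) (auto intro: add_nonneg_pos)
  also have "\<dots> \<le> qform t x * qform t y + e"
    using p e by (simp add: d_def field_simps)
  finally show "(cmod (t x y))\<^sup>2 \<le> qform t x * qform t y + e" .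
qed

text \<open>By Cauchy-Schwarz the cross term \<open>t x k\<close> vanishes.\<close>

lemma qform_diff_ker:
  assumes "t \<in> forms scale" "k \<in> ker_form t"
  shows "qform t (x - k) = qform t x"
  using cauchy_schwarz[OF assms(1), of x k] assms(2) qform_diff[OF v assms(1), of x k]
  by (simp add: ker_form_def)

lemma subspace_ker_form:
  assumes t: "t \<in> forms scale"
  shows "subspace (ker_form t)"
proof (rule subspaceI)
  show scl: "scale c x \<in> ker_form t" if "x \<in> ker_form t" for c x
    using that by (simp add: ker_form_def qform_scale[OF t])
  show "0 \<in> ker_form t"
    using qform_scale[OF t, of 0 0] by (simp add: ker_form_def)
  show "x + y \<in> ker_form t" if "x \<in> ker_form t" "y \<in> ker_form t" for x y
    using qform_diff_ker[OF t scl[OF that(2), of "-1"], of x] that(1)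
    by (simp add: ker_form_def scale_minus_left)
qed

section \<open>The short as a greatest minorant\<close>

lemma
  assumes "t \<in> forms scale" "subspace Y"
  shows short_form: "short scale t Y \<in> forms scale"
    and qform_short: "qform (short scale t Y) x = (INF y\<in>Y. qform t (x - y))"
  using theI'[OF ex1_short[OF v assms]] unfolding short_def by blast+

lemma qform_short_le:
  assumes "t \<in> forms scale" "subspace Y" "y \<in> Y"
  shows "qform (short scale t Y) x \<le> qform t (x - y)"
  unfolding qform_short[OF assms(1,2)]
  by (rule cINF_lower[OF bdd_belowI[where m = 0] assms(3)]) (auto intro: qform_nonneg[OF assms(1)])

lemma short_le:
  assumes "t \<in> forms scale" "subspace Y"
  shows "form_le (short scale t Y) t"
  using qform_short_le[OF assms subspace_0[OF assms(2)]] by (simp add: form_le_def)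

lemma subset_ker_short:
  assumes t: "t \<in> forms scale" and Y: "subspace Y"
  shows "Y \<subseteq> ker_form (short scale t Y)"
proof
  fix y assume "y \<in> Y"
  from qform_short_le[OF t Y this, of y] qform_scale[OF t, of 0 0]
  show "y \<in> ker_form (short scale t Y)"
    using qform_nonneg[OF short_form[OF t Y], of y] by (simp add: ker_form_def)
qed

lemma le_qform_short:
  assumes "t \<in> forms scale" "subspace Y" "\<And>y. y \<in> Y \<Longrightarrow> b \<le> qform t (x - y)"
  shows "b \<le> qform (short scale t Y) x"
  unfolding qform_short[OF assms(1,2)]
  using assms(3) subspace_0[OF assms(2)] by (intro cINF_greatest) auto

lemma short_greatest:
  assumes "t \<in> forms scale" "subspace Y" "s \<in> forms scale" "form_le s t" "Y \<subseteq> ker_form s"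
  shows "form_le s (short scale t Y)"
  unfolding form_le_def
proof
  fix x
  have "qform s x \<le> qform t (x - y)" if "y \<in> Y" for y
    using assms(4,5) that qform_diff_ker[OF assms(3), of y x] by (metis form_le_def subsetD)
  then show "qform s x \<le> qform (short scale t Y) x" by (rule le_qform_short[OF assms(1,2)])
qed

section \<open>Absolute continuity and singularity\<close>

lemma abs_cont_if_le:
  assumes "s \<in> forms scale" "form_le s w"
  shows "abs_cont s w"
  unfolding abs_cont_def
proof
  fix x assume "x \<in> ker_form w"
  then show "x \<in> ker_form s"
    using assms(2) qform_nonneg[OF assms(1), of x]
    by (auto simp: ker_form_def form_le_def intro: antisym dest: spec[of _ x])
qed

text \<open>
  Sums of singular forms need not be singular. Here the short of \<open>(t - t\<^sub>K) + r\<close> to \<open>K = ker w\<close> is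
  just \<open>r\<close>, because \<open>r\<close> vanishes on \<open>K\<close>.
\<close>

lemma singular_diff_short_add:
  assumes t: "t \<in> forms scale" and w: "w \<in> forms scale" and r: "r \<in> forms scale"
    and le: "form_le r (short scale t (ker_form w))" and sing: "singular scale r w"
  shows "singular scale (t - short scale t (ker_form w) + r) w"
  unfolding singular_def
proof (intro ballI impI)
  define K where "K = ker_form w"
  define s where "s = short scale t K"
  have K: "subspace K" unfolding K_def by (rule subspace_ker_form[OF w])
  have s: "s \<in> forms scale" and Ks: "K \<subseteq> ker_form s"
    unfolding s_def using short_form[OF t K] subset_ker_short[OF t K] .
  have Kr: "K \<subseteq> ker_form r"
    using Ks abs_cont_if_le[OF r, of s] le unfolding abs_cont_def s_def K_def by blast
  fix u
  assume u: "u \<in> forms scale"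
    and "form_le u (t - short scale t (ker_form w) + r) \<and> form_le u w"
  then have ut: "form_le u (t - s + r)" and uw: "form_le u w"
    by (simp_all add: s_def K_def)
  have Ku: "K \<subseteq> ker_form u"
    using abs_cont_if_le[OF u uw] by (simp add: abs_cont_def K_def)
  have "form_le u r"
    unfolding form_le_def
  proof
    fix x
    \<comment> \<open>Only \<open>t\<close> feels the shift by \<open>y\<close>: the other three
      forms vanish on \<open>K\<close>. Taking the infimum over \<open>y\<close> turns the right
      side into \<open>qform s x\<close>, which cancels.\<close>
    have "qform u x + qform s x - qform r x \<le> qform t (x - y)" if y: "y \<in> K" for y
    proof -
      have "qform u (x - y) = qform u x" "qform s (x - y) = qform s x"
        "qform r (x - y) = qform r x"
        using y Ku Ks Kr qform_diff_ker u s r by blast+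
      then show ?thesis using ut[unfolded form_le_def, rule_format, of "x - y"] by simp
    qed
    from le_qform_short[OF t K this] show "qform u x \<le> qform r x"
      by (simp add: s_def)
  qed
  then show "u = 0" using sing u uw by (simp add: singular_def)
qed

text \<open>A form below the rank one form vanishes on the kernel of \<open>f\<close>, a hyperplane,
  so it is a multiple of that rank one form. A nonzero multiple below \<open>w\<close> would make
  \<open>f\<close> bounded with respect to \<open>w\<close>.\<close>

lemma singular_rank_one:
  assumes add: "\<And>x y. f (x + y) = f x + f y" and scl: "\<And>c x. f (scale c x) = c * f x"
    and unbdd: "\<And>C. \<exists>x. C * qform w x < (cmod (f x))\<^sup>2"
    and w: "w \<in> forms scale"
  shows "singular scale (\<lambda>x y. f x * cnj (f y)) w"
  unfolding singular_def
proof (intro ballI impI)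
  fix u
  assume u: "u \<in> forms scale"
    and "form_le u (\<lambda>x y. f x * cnj (f y)) \<and> form_le u w"
  then have uf: "qform u x \<le> (cmod (f x))\<^sup>2" and uw: "qform u x \<le> qform w x" for x
    by (simp_all add: form_le_def qform_rank_one)
  obtain z where z: "f z \<noteq> 0" using unbdd[of 0] by auto
  define e where "e = scale (inverse (f z)) z"
  have fe: "f e = 1" using z by (simp add: e_def scl)
  have ux: "qform u x = (cmod (f x))\<^sup>2 * qform u e" for x
  proof -
    define k where "k = x - scale (f x) e"
    have "f k + f (scale (f x) e) = f x" unfolding add[symmetric] k_def by simp
    then have "f k = 0" by (simp add: scl fe)
    then have "k \<in> ker_form u"
      using uf[of k] qform_nonneg[OF u, of k] by (simp add: ker_form_def)
    from qform_diff_ker[OF u this, of x] show ?thesis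
      by (simp add: k_def qform_scale[OF u])
  qed
  have ue: "qform u e = 0"
  proof (rule ccontr)
    assume "qform u e \<noteq> 0"
    then have pos: "qform u e > 0" using qform_nonneg[OF u, of e] by simp
    obtain x where "1 / qform u e * qform w x < (cmod (f x))\<^sup>2" using unbdd by blast
    then have "qform w x < qform u x" using pos by (simp add: ux[of x] field_simps)
    then show False using uw[of x] by simp
  qed
  have "qform u x = 0" for x using ux[of x] by (simp add: ue)
  then show "u = 0" by (intro form_eqI[OF v u zero_form]) simp
qed

section \<open>A dominated functional that is not \<open>w\<close>-bounded\<close>

text \<open>
  The gliding hump: \<open>f\<close> is the limit of \<open>s (\<cdot>, y n)\<close> where \<open>y\<close> moves by \<open>\<plusminus> 3\<^sup>-\<^sup>n\<^sup>-\<^sup>1 x n\<close> in step \<open>n\<close>, the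
  sign being chosen so that \<open>s (x n, y (Suc n))\<close> is at least as large as the increment. The later
  increments amount to at most half of it.
\<close>

lemma unbounded_functional:
  assumes s: "s \<in> forms scale" and w: "w \<in> forms scale" and nd: "\<not> dominated s w"
  obtains f where "\<And>x y. f (x + y) = f x + f y" "\<And>c x. f (scale c x) = c * f x"
    "\<And>x. (cmod (f x))\<^sup>2 \<le> qform s x" "\<And>C. \<exists>x. C * qform w x < (cmod (f x))\<^sup>2"
proof -
  \<comment> \<open>Ratio 1/3 makes the increments after step \<open>n\<close> sum to
    \<open>3 / 2 * g (Suc n) = g n / 2\<close>, half of \<open>g n\<close>.\<close>
  define g where "g n = (1 / 3 :: real) ^ Suc n" for n
  have g0: "g n > 0" for n by (simp add: g_def)
  have gs: "(\<lambda>k. g (k + n)) sums (3 / 2 * g n)" for n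
    using sums_mult2[OF geometric_sums[of "1 / 3 :: real"], of "g n"]
    by (simp add: g_def power_add mult_ac)
  have s_add: "s (x + x') y = s x y + s x' y" "s x (y + y') = s x y + s x y'"
    and s_scale: "s (scale c x) y = c * s x y" "s x (scale c y) = cnj c * s x y" for x x' y y' c
    using s unfolding forms_def by blast+

  \<comment> \<open>Failure of domination with constant \<open>16 ^ n\<close>, normalised. The base
    only has to exceed 9, since \<open>(g n)\<^sup>2\<close> decays like
    \<open>1 / 9 ^ n\<close>.\<close>
  have "\<exists>x. qform s x = 1 \<and> 16 ^ n * qform w x < 1" for n :: nat
  proof -
    have "\<not> form_le s (\<lambda>x y. of_real (16 ^ n) * w x y)"
      using nd unfolding dominated_def by (metis zero_le_numeral zero_le_power)
    then obtain z where z: "16 ^ n * qform w z < qform s z"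
      unfolding form_le_def qform_simps not_all not_le by blast
    moreover have "0 \<le> 16 ^ n * qform w z" using qform_nonneg[OF w] by simp
    ultimately have pos: "qform s z > 0" by linarith
    define c where "c = complex_of_real (1 / sqrt (qform s z))"
    have "(cmod c)\<^sup>2 = 1 / qform s z" using pos by (simp add: c_def norm_divide power_divide)
    then have "qform s (scale c z) = 1" "qform w (scale c z) = qform w z / qform s z"
      using pos by (simp_all add: qform_scale[OF s] qform_scale[OF w])
    then show ?thesis using z pos by (intro exI[of _ "scale c z"]) simp
  qed
  then obtain x where x: "\<And>n. qform s (x n) = 1" "\<And>n. 16 ^ n * qform w (x n) < 1"
    using choice[of "\<lambda>n x. qform s x = 1 \<and> 16 ^ n * qform w x < 1"] by auto

  have "\<exists>y. \<forall>n. (n = 0 \<longrightarrow> y n = 0) \<and> qform s (y (Suc n) - y n) = (g n)\<^sup>2 \<and> g n \<le> cmod (s (x n) (y (Suc n)))"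
  proof (rule dependent_nat_choice)
    fix y n
    define d where "d = scale (of_real (g n)) (x n)"
    have qd: "qform s d = (g n)\<^sup>2" by (simp add: d_def qform_scale[OF s] x)
    have "Re (s (x n) d) = g n" using x(1)[of n] by (simp add: d_def s_scale qform_def)
    then have sd: "g n \<le> cmod (s (x n) d)" using complex_Re_le_cmod[of "s (x n) d"] by simp
    \<comment> \<open>Of the two candidates \<open>y + d\<close> and \<open>y - d\<close>, at least
      one pairs with \<open>x n\<close> to modulus at least that of
      \<open>s (x n) d\<close>.\<close>
    have "2 * s (x n) d = s (x n) (y + d) - s (x n) (y - d)"
      by (simp add: s_add form_diff[OF v s])
    then have "2 * cmod (s (x n) d) \<le> cmod (s (x n) (y + d)) + cmod (s (x n) (y - d))"
      by (metis norm_mult norm_numeral norm_triangle_ineq4)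
    then consider "g n \<le> cmod (s (x n) (y + d))" | "g n \<le> cmod (s (x n) (y - d))"
      using sd by linarith
    then show "\<exists>y'. (Suc n = 0 \<longrightarrow> y' = 0) \<and> qform s (y' - y) = (g n)\<^sup>2 \<and> g n \<le> cmod (s (x n) y')"
    proof cases
      case 1
      then show ?thesis using qd by (intro exI[of _ "y + d"]) simp
    next
      case 2
      have "qform s (y - d - y) = (g n)\<^sup>2"
        using qd qform_scale[OF s, of "-1" d] by (simp add: scale_minus_left)
      then show ?thesis using 2 by blast
    qed
  qed simp
  then obtain y where y0: "y 0 = 0" and y: "\<And>n. qform s (y (Suc n) - y n) = (g n)\<^sup>2"
    "\<And>n. g n \<le> cmod (s (x n) (y (Suc n)))" by blast

  have diff_le: "cmod (s z (y (Suc n) - y n)) \<le> g n * sqrt (qform s z)" for z n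
  proof -
    have "(cmod (s z (y (Suc n) - y n)))\<^sup>2 \<le> (g n * sqrt (qform s z))\<^sup>2"
      using cauchy_schwarz[OF s, of z "y (Suc n) - y n"] qform_nonneg[OF s, of z]
      by (simp add: y power_mult_distrib mult.commute)
    then show ?thesis
      by (rule power2_le_imp_le) (use g0[of n] qform_nonneg[OF s, of z] in simp)
  qed
  \<comment> \<open>Tails of the series for the functional, which is \<open>F 0\<close>. The points
    \<open>y n\<close> need not converge in the space; only their pairings with each fixed
    \<open>z\<close> do.\<close>
  define F where "F m z = (\<Sum>k. s z (y (Suc (k + m)) - y (k + m)))" for m z
  have bnd: "(\<lambda>k. g (k + m) * sqrt (qform s z)) sums (3 / 2 * g m * sqrt (qform s z))" for m z
    by (rule sums_mult2[OF gs])
  have abs: "summable (\<lambda>k. cmod (s z (y (Suc (k + m)) - y (k + m))))" for m z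
    by (rule summable_comparison_test'[OF sums_summable[OF bnd[of m z]], of 0])
      (simp add: diff_le)
  have summ: "summable (\<lambda>k. s z (y (Suc (k + m)) - y (k + m)))" for m z
    by (rule summable_norm_cancel[OF abs])
  have F_le: "cmod (F m z) \<le> 3 / 2 * g m * sqrt (qform s z)" for m z
  proof -
    have "cmod (F m z) \<le> (\<Sum>k. cmod (s z (y (Suc (k + m)) - y (k + m))))"
      unfolding F_def by (rule summable_norm[OF abs])
    also have "\<dots> \<le> (\<Sum>k. g (k + m) * sqrt (qform s z))"
      by (rule suminf_le[OF _ abs sums_summable[OF bnd]]) (rule diff_le)
    also have "\<dots> = 3 / 2 * g m * sqrt (qform s z)" by (rule sums_unique[OF bnd, symmetric])
    finally show ?thesis .
  qed
  have F_split: "F 0 z = F n z + s z (y n)" for n z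
  proof -
    have "(\<Sum>k<n. s z (y (Suc k) - y k)) = s z (y n)"
      using form_diff(2)[OF v s, of z 0 0] sum_lessThan_telescope[of "\<lambda>k. s z (y k)" n]
      by (simp add: form_diff[OF v s] y0)
    then show ?thesis
      using suminf_split_initial_segment[OF summ[of z 0], of n] by (simp add: F_def)
  qed
  show thesis
  proof (rule that[of "F 0"])
    show "F 0 (z + z') = F 0 z + F 0 z'" for z z'
      unfolding F_def s_add by (rule suminf_add[symmetric]) (rule summ)+
    show "F 0 (scale c z) = c * F 0 z" for c z
      unfolding F_def s_scale by (rule suminf_mult[OF summ])
    show "(cmod (F 0 z))\<^sup>2 \<le> qform s z" for z
    proof -
      have "cmod (F 0 z) \<le> sqrt (qform s z)"
        using F_le[of 0 z] norm_ge_zero[of "F 0 z"] unfolding g_def by (simp del: norm_ge_zero)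
      from power_mono[OF this, of 2] show ?thesis using qform_nonneg[OF s, of z] by simp
    qed
    show "\<exists>z. C * qform w z < (cmod (F 0 z))\<^sup>2" for C
    proof -
      \<comment> \<open>The 36 comes from \<open>(g n / 2)\<^sup>2 = 1 / (36 * 9 ^ n)\<close>; using
        \<bar>C\<bar> + 1 in place of \<open>C\<close> keeps the factor positive.\<close>
      have "0 < 36 * (\<bar>C\<bar> + 1)" by (simp add: add_nonneg_pos)
      then obtain n where "(9 / 16 :: real) ^ n < 1 / (36 * (\<bar>C\<bar> + 1))"
        using real_arch_pow_inv[of "1 / (36 * (\<bar>C\<bar> + 1))" "9 / 16"] by auto
      then have C: "(\<bar>C\<bar> + 1) / 16 ^ n < 1 / (36 * 9 ^ n)"
        by (simp add: field_simps)
      have "g n / 2 = 1 / (6 * 3 ^ n)" by (simp add: g_def power_divide)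
      then have "(g n / 2)\<^sup>2 = 1 / (36 * 9 ^ n)"
        using power_mult_distrib[of "3 :: real" 3 n] by (simp add: power2_eq_square)
      with C have n: "(\<bar>C\<bar> + 1) / 16 ^ n < (g n / 2)\<^sup>2" by (simp only:)
      have "C * qform w (x n) \<le> (\<bar>C\<bar> + 1) * qform w (x n)"
        using qform_nonneg[OF w] by (intro mult_right_mono) auto
      also have "\<dots> \<le> (\<bar>C\<bar> + 1) / 16 ^ n"
        using x(2)[of n] mult_left_mono[of "16 ^ n * qform w (x n)" 1 "\<bar>C\<bar> + 1"]
        by (simp add: field_simps)
      also note n
      also have "(g n / 2)\<^sup>2 \<le> (cmod (F 0 (x n)))\<^sup>2"
      proof (rule power_mono)
        \<comment> \<open>The pairing after step \<open>n\<close> is at least \<open>g n\<close>,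
          and the tail \<open>F (Suc n)\<close> removes at most \<open>g n / 2\<close>.\<close>
        have "cmod (s (x n) (y (Suc n))) \<le> cmod (F 0 (x n)) + cmod (F (Suc n) (x n))"
          using norm_triangle_ineq4[of "F 0 (x n)" "F (Suc n) (x n)"] F_split[of "x n" "Suc n"]
          by simp
        then show "g n / 2 \<le> cmod (F 0 (x n))"
          using y(2)[of n] F_le[of "Suc n" "x n"] by (simp add: x g_def)
      qed (use g0[of n] in simp)
      finally show ?thesis by blast
    qed
  qed
qed

end

section \<open>Existence, maximality and uniqueness\<close>

theorem theorem1p2:
  fixes scale :: "complex \<Rightarrow> 'a::ab_group_add \<Rightarrow> 'a"
    and t w :: "'a \<Rightarrow> 'a \<Rightarrow> complex"
  assumes "vector_space scale"
    and "t \<in> forms scale"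
    and "w \<in> forms scale"
  shows "short_type_decomp scale t w
           (short scale t (ker_form w), t - short scale t (ker_form w)) \<and>
         (short scale t (ker_form w) \<in> {s \<in> forms scale. form_le s t \<and> abs_cont s w} \<and>
          (\<forall>s \<in> {s \<in> forms scale. form_le s t \<and> abs_cont s w}.
             form_le s (short scale t (ker_form w)))) \<and>
         ((\<exists>!p. short_type_decomp scale t w p) \<longleftrightarrow>
            dominated (short scale t (ker_form w)) w)"
proof -
  interpret vector_space scale by fact
  note v = \<open>vector_space scale\<close> and t = \<open>t \<in> forms scale\<close> and w = \<open>w \<in> forms scale\<close>
  define s where "s = short scale t (ker_form w)"
  note K = subspace_ker_form[OF v w]
  have s: "s \<in> forms scale" and st: "form_le s t" and sw: "abs_cont s w"
    unfolding s_def abs_cont_def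
    using short_form[OF v t K] short_le[OF v t K] subset_ker_short[OF v t K] .
  have max: "form_le r s" if "r \<in> forms scale" "form_le r t" "abs_cont r w" for r
    using short_greatest[OF v t K that(1,2)] that(3) by (simp add: s_def abs_cont_def)
  \<comment> \<open>Moving \<open>r\<close> between the summands serves twice: \<open>r = 0\<close>
    gives the canonical decomposition, a rank one \<open>r\<close> a competing one.\<close>
  have decomp: "short_type_decomp scale t w (s - r, t - s + r)"
    if r: "r \<in> forms scale" "form_le r s" "singular scale r w" for r
  proof -
    have "form_le (s - r) s" using qform_nonneg[OF r(1)] by (simp add: form_le_def)
    moreover have "s - r \<in> forms scale" by (rule diff_form[OF r(1) s r(2)])
    ultimately have "abs_cont (s - r) w"
      using sw abs_cont_if_le[OF v] unfolding abs_cont_def by blast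
    moreover have "singular scale (t - s + r) w"
      using singular_diff_short_add[OF v t w r(1)] r(2,3) by (simp add: s_def)
    ultimately show ?thesis
      using \<open>s - r \<in> forms scale\<close> add_form[OF diff_form[OF s t st] r(1)]
      by (simp add: short_type_decomp_def)
  qed
  have zero_sing: "singular scale 0 w"
    unfolding singular_def
    using form_le_antisym[OF v _ zero_form] qform_nonneg by (fastforce simp: form_le_def)
  have d0: "short_type_decomp scale t w (s, t - s)"
    using decomp[OF zero_form _ zero_sing] qform_nonneg[OF s] by (simp add: form_le_def)
  have "(\<exists>!p. short_type_decomp scale t w p) \<longleftrightarrow> dominated s w"
  proof
    assume uniq: "\<exists>!p. short_type_decomp scale t w p"
    show "dominated s w"
    proof (rule ccontr)
      assume nd: "\<not> dominated s w"
      obtain f where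
        f: "\<And>x y. f (x + y) = f x + f y" "\<And>c x. f (scale c x) = c * f x"
          "\<And>x. (cmod (f x))\<^sup>2 \<le> qform s x" "\<And>C. \<exists>x. C * qform w x < (cmod (f x))\<^sup>2"
        by (rule unbounded_functional[OF v s w nd]) blast
      let ?r = "\<lambda>x y. f x * cnj (f y)"
      have "short_type_decomp scale t w (s - ?r, t - s + ?r)"
        using f(3) by (intro decomp rank_one_form singular_rank_one[OF v] f(1,2,4) w)
          (simp add: form_le_def qform_rank_one)
      with d0 uniq have "s - ?r = s" by blast
      then have "qform (s - ?r) x = qform s x" for x by (rule arg_cong)
      then have "f x = 0" for x unfolding qform_simps qform_rank_one by simp
      then show False using f(4)[of 0] by simp
    qed
  next
    assume "dominated s w"
    then obtain c where c: "0 \<le> c" "\<And>x. qform s x \<le> c * qform w x"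
      by (auto simp: dominated_def form_le_def)
    show "\<exists>!p. short_type_decomp scale t w p"
    proof (rule ex1I[where P = "short_type_decomp scale t w", OF d0])
      fix p assume "short_type_decomp scale t w p"
      then obtain t1 t2 where p: "p = (t1, t2)" and t1: "t1 \<in> forms scale" "abs_cont t1 w"
        and t2: "t2 \<in> forms scale" "singular scale t2 w" and eq: "t = t1 + t2"
        by (cases p) (auto simp: short_type_decomp_def)
      have "form_le t1 t" using qform_nonneg[OF t2(1)] by (simp add: form_le_def eq)
      then have le: "form_le t1 s" using max t1 by blast
      \<comment> \<open>Singularity needs one form below both \<open>t2\<close> and
        \<open>w\<close>: \<open>b \<le> 1\<close> keeps the scaled difference below
        \<open>t2\<close>, and \<open>b * c \<le> 1\<close> keeps it below \<open>w\<close>. The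
        summand 1 covers \<open>c = 0\<close>.\<close>
      define b where "b = 1 / (c + 1)"
      have b: "0 < b" "b \<le> 1" "b * c \<le> 1" using c(1) by (auto simp: b_def)
      define u where "u = (\<lambda>x y. of_real b * (s - t1) x y)"
      have u: "u \<in> forms scale" unfolding u_def
        using b by (intro scaled_form diff_form[OF t1(1) s le]) auto
      have qu: "qform u x = b * (qform s x - qform t1 x)" for x
        unfolding u_def qform_simps ..
      have "form_le u t2" unfolding form_le_def
      proof
        fix x
        have "0 \<le> qform s x - qform t1 x" "qform s x - qform t1 x \<le> qform t2 x"
          using le st by (simp_all add: form_le_def eq algebra_simps)
        then show "qform u x \<le> qform t2 x"
          using b mult_right_mono[of b 1 "qform s x - qform t1 x"] by (simp add: qu)
      qed
      moreover have "form_le u w" unfolding form_le_def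
      proof
        fix x
        have "qform u x \<le> b * (c * qform w x)"
          unfolding qu using c(2)[of x] qform_nonneg[OF t1(1), of x] b(1)
          by (intro mult_left_mono) auto
        also have "\<dots> \<le> qform w x"
          using mult_right_mono[OF b(3) qform_nonneg[OF w, of x]] by (simp add: mult.assoc)
        finally show "qform u x \<le> qform w x" .
      qed
      ultimately have "u = 0" using t2(2) u by (simp add: singular_def)
      then have "qform t1 x = qform s x" for x using qu[of x] b(1) by simp
      then have "t1 = s" by (rule form_eqI[OF v t1(1) s])
      then show "p = (s, t - s)" by (simp add: p eq)
    qed
  qed
  then show ?thesis using d0 s st sw max by (simp add: s_def)
qed

end
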